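(* Let $k$ be a commutative ring and let $A$ be a multiplier Hopf algebra over $k$. Then a linear map $S\in\mathrm{Hom}(A,\mathbb{M}(A))$ is the antipode of $A$ if and only if $S$ is a (left-right) convolution inverse of $\iota_A$ in $\mathrm{Hom}(A,\mathbb{M}(A))$.
   Context: Conventions. $k$ is a commutative ring, all modules are $k$-modules, linear means $k$-linear, $\otimes=\otimes_k$, $\mathrm{Hom}=\mathrm{Hom}_k$. An algebra is a $k$-module with an associative linear multiplication (no unit assumed); an algebra map is a linear multiplicative map. An algebra $A$ is non-degenerate if for every $a\in A$: $a=0$ whenever $ab=0$ for all $b\in A$, and $a=0$ whenever $ba=0$ for all $b\in A$; $k$-projective if projective as a $k$-module. $A\otimes A$ is an algebra with componentwise multiplication. $\mathbb{M}(A)$ is the set of pairs $x=(\lambda,\rho)$ with $\lambda:A\to A$ right $A$-linear, $\rho:A\to A$ left $A$-linear and $a\lambda(b)=\rho(a)b$ for all $a,b$; it is a unital algebra with product $(\lambda_x\circ\lambda_y,\rho_y\circ\rho_x)$. Write $x\rhd a=\lambda(a)$, $a\lhd x=\rho(a)$, $\iota_A(a)=(b\mapsto ab,\ b\mapsto ba)\in\mathbb{M}(A)$. In $\mathbb{M}(A\otimes A)$, $1\otimes b$ is the multiplier with $(1\otimes b)\rhd(c\otimes d)=c\otimes bd$, $(c\otimes d)\lhd(1\otimes b)=c\otimes db$; similarly for $a\otimes 1$, $a\otimes1\otimes1$, $1\otimes1\otimes c$. Multiplier Hopf algebra. A multiplier Hopf algebra is a non-degenerate $k$-projective algebra $A$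 with an algebra map $\widetilde\Delta:A\to\mathbb{M}(A\otimes A)$ such that: (1) $\widetilde\Delta(a)(1\otimes b)$ and $(a\otimes1)\widetilde\Delta(b)$ lie in $\iota_{A\otimes A}(A\otimes A)$ for all $a,b$; (2) $(a\otimes1\otimes1)(\widetilde\Delta\otimes A)(\widetilde\Delta(b)(1\otimes c))=(A\otimes\widetilde\Delta)((a\otimes1)\widetilde\Delta(b))(1\otimes1\otimes c)$ for all $a,b,c\in A$ (identifying $A\otimes A$ with its image under $\iota_{A\otimes A}$); (3) with the notation (summation understood) $\widetilde\Delta(a)(1\otimes b)=\iota_{A\otimes A}(a_{(1,b)}\otimes a_{(2,b)})$ and $(b\otimes1)\widetilde\Delta(a)=\iota_{A\otimes A}(a_{(b,1)}\otimes a_{(b,2)})$, the maps $T_1(a\otimes b)=a_{(1,b)}\otimes a_{(2,b)}$ and $T_2(a\otimes b)=b_{(a,1)}\otimes b_{(a,2)}$ are bijections $A\otimes A\to A\otimes A$. By Van Daele, $A$ has a counit, i.e. an algebra map $\widetilde\varepsilon:A\to k$ with $b_{(a,1)}\widetilde\varepsilon(b_{(a,2)})=ab=\widetilde\varepsilon(a_{(1,b)})a_{(2,b)}$ for all $a,b\in A$, and an antipode, which is the unique linear map $S:A\to\mathbb{M}(A)$ satisfying, for all $a,b\in A$, $$S(a_{(1,b)})\rhd a_{(2,b)}=\widetilde\varepsilon(a)b,\qquad b_{(a,1)}\lhd S(b_{(a,2)})=a\,\widetilde\varepsilon(b).$$ Convolution inverse. Let $R=\mathrm{Hom}(A,\mathbb{M}(A))$.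 For $f,g\in R$ and $b\in A$ define $f\ast^b g,\ f\ast_b g\in R$ by $(f\ast^b g)(a)=f(a_{(1,b)})g(a_{(2,b)})$ and $(f\ast_b g)(a)=f(a_{(b,1)})g(a_{(b,2)})$, and let $f\ast^1 g,\ f\ast_2 g\in\mathrm{Hom}(A,R)$ be the maps $b\mapsto f\ast^b g$ and $b\mapsto f\ast_b g$. Let $\alpha\in\mathrm{Hom}(A,R)$ be $\alpha(b)(a)=\widetilde\varepsilon(a)\iota_A(b)$. An element $\bar f\in R$ is a (left-right) convolution inverse of $f\in R$ if $\bar f\ast^1 f=\alpha=f\ast_2\bar f$. *)

theory Defs
  imports "HOL-Algebra.Module" "HOL-Algebra.Coset" "HOL-Algebra.Generated_Groups"
    "HOL-Algebra.Free_Abelian_Groups"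
begin

text \<open>
  All algebraic structures are records with explicit carriers.  Maps out of a carrier are extensional
  (\<open>undefined\<close> outside the carrier), so that equality of maps is equality on the carrier.
  The record type \<open>module\<close> inherits from \<open>ring\<close> the fields \<open>mult\<close> and
  \<open>one\<close>; \<open>mult\<close> is the multiplication of an algebra, whereas \<open>one\<close>
  is ignored unless the algebra is known to be unital.
\<close>

section \<open>Modules and algebras without unit\<close>

definition linear_maps ::
    "('k, 'm) ring_scheme \<Rightarrow> ('k, 'a, 'n) module_scheme \<Rightarrow> ('k, 'b, 'p) module_scheme \<Rightarrow> ('a \<Rightarrow> 'b) set" where
  "linear_maps k M N = {f \<in> carrier M \<rightarrow>\<^sub>E carrier N.
     (\<forall>x\<in>carrier M. \<forall>y\<in>carrier M. f (x \<oplus>\<^bsub>M\<^esub> y) = f x \<oplus>\<^bsub>N\<^esub> f y) \<and>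
     (\<forall>r\<in>carrier k. \<forall>x\<in>carrier M. f (r \<odot>\<^bsub>M\<^esub> x) = r \<odot>\<^bsub>N\<^esub> f x)}"

definition algebra_maps ::
    "('k, 'm) ring_scheme \<Rightarrow> ('k, 'a, 'n) module_scheme \<Rightarrow> ('k, 'b, 'p) module_scheme \<Rightarrow> ('a \<Rightarrow> 'b) set" where
  "algebra_maps k A B = {f \<in> linear_maps k A B.
     \<forall>x\<in>carrier A. \<forall>y\<in>carrier A. f (x \<otimes>\<^bsub>A\<^esub> y) = f x \<otimes>\<^bsub>B\<^esub> f y}"

definition scalar_algebra :: "('k, 'm) ring_scheme \<Rightarrow> ('k, 'k) module" where
  "scalar_algebra k = \<lparr>carrier = carrier k, monoid.mult = monoid.mult k, monoid.one = monoid.one k,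
     ring.zero = \<zero>\<^bsub>k\<^esub>, ring.add = ring.add k, smult = monoid.mult k\<rparr>"

text \<open>The free module on a set \<open>I\<close>: finitely supported families of scalars.\<close>

definition free_module :: "('k, 'm) ring_scheme \<Rightarrow> 'i set \<Rightarrow> ('k, 'i \<Rightarrow> 'k) module" where
  "free_module k I = \<lparr>carrier = {f \<in> I \<rightarrow>\<^sub>E carrier k. finite {i \<in> I. f i \<noteq> \<zero>\<^bsub>k\<^esub>}},
     mult = undefined, one = undefined,
     ring.zero = (\<lambda>i\<in>I. \<zero>\<^bsub>k\<^esub>),
     ring.add = (\<lambda>f g. \<lambda>i\<in>I. f i \<oplus>\<^bsub>k\<^esub> g i),
     smult = (\<lambda>r f. \<lambda>i\<in>I. r \<otimes>\<^bsub>k\<^esub> f i)\<rparr>"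

text \<open>
  Projective means: (isomorphic to) a direct summand of a free module.  It is no restriction to take
  the basis \<open>I\<close> inside the type of the module, since a projective module is a direct
  summand of the free module on its own elements.
\<close>

definition projective_module :: "('k, 'm) ring_scheme \<Rightarrow> ('k, 'a, 'n) module_scheme \<Rightarrow> bool" where
  "projective_module k P \<longleftrightarrow> module k P \<and>
     (\<exists>(I :: 'a set) s p. s \<in> linear_maps k P (free_module k I) \<and>
        p \<in> linear_maps k (free_module k I) P \<and> (\<forall>x\<in>carrier P. p (s x) = x))"

locale nonunital_algebra = module k A for k (structure) and A (structure) +
  assumes mult_closed: "x \<in> carrier A \<Longrightarrow> y \<in> carrier A \<Longrightarrow> x \<otimes>\<^bsub>A\<^esub> y \<in> carrier A"
    and mult_assoc: "x \<in> carrier A \<Longrightarrow> y \<in> carrier A \<Longrightarrow> z \<in> carrier A \<Longrightarrow>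
      (x \<otimes>\<^bsub>A\<^esub> y) \<otimes>\<^bsub>A\<^esub> z = x \<otimes>\<^bsub>A\<^esub> (y \<otimes>\<^bsub>A\<^esub> z)"
    and mult_add_left: "x \<in> carrier A \<Longrightarrow> y \<in> carrier A \<Longrightarrow> z \<in> carrier A \<Longrightarrow>
      (x \<oplus>\<^bsub>A\<^esub> y) \<otimes>\<^bsub>A\<^esub> z = x \<otimes>\<^bsub>A\<^esub> z \<oplus>\<^bsub>A\<^esub> y \<otimes>\<^bsub>A\<^esub> z"
    and mult_add_right: "x \<in> carrier A \<Longrightarrow> y \<in> carrier A \<Longrightarrow> z \<in> carrier A \<Longrightarrow>
      z \<otimes>\<^bsub>A\<^esub> (x \<oplus>\<^bsub>A\<^esub> y) = z \<otimes>\<^bsub>A\<^esub> x \<oplus>\<^bsub>A\<^esub> z \<otimes>\<^bsub>A\<^esub> y"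
    and mult_smult_left: "r \<in> carrier k \<Longrightarrow> x \<in> carrier A \<Longrightarrow> y \<in> carrier A \<Longrightarrow>
      (r \<odot>\<^bsub>A\<^esub> x) \<otimes>\<^bsub>A\<^esub> y = r \<odot>\<^bsub>A\<^esub> (x \<otimes>\<^bsub>A\<^esub> y)"
    and mult_smult_right: "r \<in> carrier k \<Longrightarrow> x \<in> carrier A \<Longrightarrow> y \<in> carrier A \<Longrightarrow>
      x \<otimes>\<^bsub>A\<^esub> (r \<odot>\<^bsub>A\<^esub> y) = r \<odot>\<^bsub>A\<^esub> (x \<otimes>\<^bsub>A\<^esub> y)"

locale nondegenerate_algebra = nonunital_algebra k A for k (structure) and A (structure) +
  assumes nondegenerate_right: "a \<in> carrier A \<Longrightarrow>
      (\<And>b. b \<in> carrier A \<Longrightarrow> a \<otimes>\<^bsub>A\<^esub> b = \<zero>\<^bsub>A\<^esub>) \<Longrightarrow> a = \<zero>\<^bsub>A\<^esub>"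
    and nondegenerate_left: "a \<in> carrier A \<Longrightarrow>
      (\<And>b. b \<in> carrier A \<Longrightarrow> b \<otimes>\<^bsub>A\<^esub> a = \<zero>\<^bsub>A\<^esub>) \<Longrightarrow> a = \<zero>\<^bsub>A\<^esub>"


section \<open>Tensor products\<close>

text \<open>
  The tensor product over \<open>k\<close> is the free abelian group on
  \<open>carrier M \<times> carrier N\<close> modulo the subgroup of bilinear, \<open>k\<close>-balanced relations.
\<close>

definition tensor_relations ::
    "('k, 'm) ring_scheme \<Rightarrow> ('k, 'a, 'n) module_scheme \<Rightarrow> ('k, 'b, 'p) module_scheme \<Rightarrow> ('a \<times> 'b \<Rightarrow>\<^sub>0 int) set" where
  "tensor_relations k M N = generate (free_Abelian_group (carrier M \<times> carrier N))
     ({frag_of (x \<oplus>\<^bsub>M\<^esub> x', y) - frag_of (x, y) - frag_of (x', y) | x x' y.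
         x \<in> carrier M \<and> x' \<in> carrier M \<and> y \<in> carrier N} \<union>
      {frag_of (x, y \<oplus>\<^bsub>N\<^esub> y') - frag_of (x, y) - frag_of (x, y') | x y y'.
         x \<in> carrier M \<and> y \<in> carrier N \<and> y' \<in> carrier N} \<union>
      {frag_of (r \<odot>\<^bsub>M\<^esub> x, y) - frag_of (x, r \<odot>\<^bsub>N\<^esub> y) | r x y.
         r \<in> carrier k \<and> x \<in> carrier M \<and> y \<in> carrier N})"

definition tensor_class ::
    "('k, 'm) ring_scheme \<Rightarrow> ('k, 'a, 'n) module_scheme \<Rightarrow> ('k, 'b, 'p) module_scheme \<Rightarrow>
     ('a \<times> 'b \<Rightarrow>\<^sub>0 int) \<Rightarrow> ('a \<times> 'b \<Rightarrow>\<^sub>0 int) set" where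
  "tensor_class k M N u =
     tensor_relations k M N #>\<^bsub>free_Abelian_group (carrier M \<times> carrier N)\<^esub> u"

text \<open>The pure tensor of \<open>x\<close> and \<open>y\<close>.\<close>

definition pure_tensor ::
    "('k, 'm) ring_scheme \<Rightarrow> ('k, 'a, 'n) module_scheme \<Rightarrow> ('k, 'b, 'p) module_scheme \<Rightarrow>
     'a \<Rightarrow> 'b \<Rightarrow> ('a \<times> 'b \<Rightarrow>\<^sub>0 int) set" where
  "pure_tensor k M N x y = tensor_class k M N (frag_of (x, y))"

text \<open>
  Scalar multiplication and the componentwise multiplication are computed on representatives; the
  unions are over representatives of the same class(es), so that they yield a single coset.
\<close>

definition tensor ::
    "('k, 'm) ring_scheme \<Rightarrow> ('k, 'a, 'n) module_scheme \<Rightarrow> ('k, 'b, 'p) module_scheme \<Rightarrow>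
     ('k, ('a \<times> 'b \<Rightarrow>\<^sub>0 int) set) module" where
  "tensor k M N = (let F = free_Abelian_group (carrier M \<times> carrier N) in
     \<lparr>carrier = carrier (F Mod tensor_relations k M N),
      mult = (\<lambda>X Y. \<Union>u\<in>X. \<Union>v\<in>Y. tensor_class k M N
        (frag_extend (\<lambda>(a, b). frag_extend (\<lambda>(c, d). frag_of (a \<otimes>\<^bsub>M\<^esub> c, b \<otimes>\<^bsub>N\<^esub> d)) v) u)),
      one = pure_tensor k M N \<one>\<^bsub>M\<^esub> \<one>\<^bsub>N\<^esub>,
      ring.zero = monoid.one (F Mod tensor_relations k M N),
      ring.add = monoid.mult (F Mod tensor_relations k M N),
      smult = (\<lambda>r X. \<Union>u\<in>X. tensor_class k M N
        (frag_extend (\<lambda>(a, b). frag_of (r \<odot>\<^bsub>M\<^esub> a, b)) u))\<rparr>)"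

text \<open>
  For a bilinear \<open>\<beta>\<close> with values in \<open>P\<close>, the induced map on the
  tensor product: a class represented by \<open>\<Sum>i. n i \<cdot> (x i, y i)\<close> is sent to
  \<open>\<Sum>i. n i \<cdot> \<beta> (x i) (y i)\<close>, which is the same element for all representatives.
  This is how expressions with implicit summation over a tensor are written below.
\<close>

definition tensor_lift ::
    "('k, 'c, 'q) module_scheme \<Rightarrow> ('a \<Rightarrow> 'b \<Rightarrow> 'c) \<Rightarrow> ('a \<times> 'b \<Rightarrow>\<^sub>0 int) set \<Rightarrow> 'c" where
  "tensor_lift P \<beta> X = the_elem ((\<lambda>u.
     \<Oplus>\<^bsub>P\<^esub>p\<in>Poly_Mapping.keys u. [Poly_Mapping.lookup u p] \<cdot>\<^bsub>P\<^esub> \<beta> (fst p) (snd p)) ` X)"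

definition tensor_assoc ::
    "('k, 'm) ring_scheme \<Rightarrow> ('k, 'a, 'n) module_scheme \<Rightarrow> ('k, 'b, 'p) module_scheme \<Rightarrow>
     ('k, 'c, 'q) module_scheme \<Rightarrow> ((('a \<times> 'b \<Rightarrow>\<^sub>0 int) set) \<times> 'c \<Rightarrow>\<^sub>0 int) set \<Rightarrow>
     ('a \<times> (('b \<times> 'c \<Rightarrow>\<^sub>0 int) set) \<Rightarrow>\<^sub>0 int) set" where
  "tensor_assoc k A B C = (\<lambda>t\<in>carrier (tensor k (tensor k A B) C).
     tensor_lift (tensor k A (tensor k B C))
       (\<lambda>s c. tensor_lift (tensor k A (tensor k B C))
          (\<lambda>a b. pure_tensor k A (tensor k B C) a (pure_tensor k B C b c)) s) t)"


section \<open>Multipliers\<close>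

type_synonym 'a multiplier = "('a \<Rightarrow> 'a) \<times> ('a \<Rightarrow> 'a)"

abbreviation left_action :: "'a multiplier \<Rightarrow> 'a \<Rightarrow> 'a" (infixr \<open>\<triangleright>\<close> 75) where
  "x \<triangleright> a \<equiv> fst x a"

abbreviation right_action :: "'a \<Rightarrow> 'a multiplier \<Rightarrow> 'a" (infixl \<open>\<triangleleft>\<close> 75) where
  "a \<triangleleft> x \<equiv> snd x a"

definition multiplier_algebra ::
    "('k, 'm) ring_scheme \<Rightarrow> ('k, 'a, 'n) module_scheme \<Rightarrow> ('k, 'a multiplier) module" where
  "multiplier_algebra k A = \<lparr>
     carrier = {x. fst x \<in> linear_maps k A A \<and> snd x \<in> linear_maps k A A \<and>
       (\<forall>a\<in>carrier A. \<forall>b\<in>carrier A. x \<triangleright> (a \<otimes>\<^bsub>A\<^esub> b) = (x \<triangleright> a) \<otimes>\<^bsub>A\<^esub> b) \<and>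
       (\<forall>a\<in>carrier A. \<forall>b\<in>carrier A. (a \<otimes>\<^bsub>A\<^esub> b) \<triangleleft> x = a \<otimes>\<^bsub>A\<^esub> (b \<triangleleft> x)) \<and>
       (\<forall>a\<in>carrier A. \<forall>b\<in>carrier A. a \<otimes>\<^bsub>A\<^esub> (x \<triangleright> b) = (a \<triangleleft> x) \<otimes>\<^bsub>A\<^esub> b)},
     mult = (\<lambda>x y. (\<lambda>a\<in>carrier A. x \<triangleright> (y \<triangleright> a), \<lambda>a\<in>carrier A. (a \<triangleleft> x) \<triangleleft> y)),
     one = (\<lambda>a\<in>carrier A. a, \<lambda>a\<in>carrier A. a),
     ring.zero = (\<lambda>a\<in>carrier A. \<zero>\<^bsub>A\<^esub>, \<lambda>a\<in>carrier A. \<zero>\<^bsub>A\<^esub>),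
     ring.add = (\<lambda>x y. (\<lambda>a\<in>carrier A. (x \<triangleright> a) \<oplus>\<^bsub>A\<^esub> (y \<triangleright> a), \<lambda>a\<in>carrier A. (a \<triangleleft> x) \<oplus>\<^bsub>A\<^esub> (a \<triangleleft> y))),
     smult = (\<lambda>r x. (\<lambda>a\<in>carrier A. r \<odot>\<^bsub>A\<^esub> (x \<triangleright> a), \<lambda>a\<in>carrier A. r \<odot>\<^bsub>A\<^esub> (a \<triangleleft> x)))\<rparr>"

text \<open>The canonical map \<open>\<iota>\<close> from an algebra to its multiplier algebra.\<close>

definition multiplier_embedding :: "('k, 'a, 'n) module_scheme \<Rightarrow> 'a \<Rightarrow> 'a multiplier" where
  "multiplier_embedding A =
     (\<lambda>a\<in>carrier A. (\<lambda>b\<in>carrier A. a \<otimes>\<^bsub>A\<^esub> b, \<lambda>b\<in>carrier A. b \<otimes>\<^bsub>A\<^esub> a))"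

text \<open>
  The multiplier \<open>x \<otimes> y\<close> of the tensor product algebra, for multipliers \<open>x\<close> of
  \<open>A\<close> and \<open>y\<close> of \<open>B\<close>.
\<close>

definition multiplier_tensor ::
    "('k, 'm) ring_scheme \<Rightarrow> ('k, 'a, 'n) module_scheme \<Rightarrow> ('k, 'b, 'p) module_scheme \<Rightarrow>
     'a multiplier \<Rightarrow> 'b multiplier \<Rightarrow> ('a \<times> 'b \<Rightarrow>\<^sub>0 int) set multiplier" where
  "multiplier_tensor k A B x y =
     (\<lambda>t\<in>carrier (tensor k A B).
        tensor_lift (tensor k A B) (\<lambda>c d. pure_tensor k A B (x \<triangleright> c) (y \<triangleright> d)) t,
      \<lambda>t\<in>carrier (tensor k A B).
        tensor_lift (tensor k A B) (\<lambda>c d. pure_tensor k A B (c \<triangleleft> x) (d \<triangleleft> y)) t)"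

text \<open>Transport of multipliers along an isomorphism \<open>\<phi>\<close> from \<open>B\<close> to \<open>C\<close>.\<close>

definition multiplier_transport ::
    "('k, 'b, 'n) module_scheme \<Rightarrow> ('k, 'c, 'p) module_scheme \<Rightarrow> ('b \<Rightarrow> 'c) \<Rightarrow>
     'b multiplier \<Rightarrow> 'c multiplier" where
  "multiplier_transport B C \<phi> x =
     (\<lambda>c\<in>carrier C. \<phi> (x \<triangleright> inv_into (carrier B) \<phi> c),
      \<lambda>c\<in>carrier C. \<phi> (inv_into (carrier B) \<phi> c \<triangleleft> x))"


section \<open>Multiplier Hopf algebras\<close>

type_synonym 'a tensor2 = "('a \<times> 'a \<Rightarrow>\<^sub>0 int) set"

text \<open>The multipliers \<open>\<Delta>(a)(1 \<otimes> b)\<close> and \<open>(a \<otimes> 1)\<Delta>(b)\<close>.\<close>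

definition comult_right ::
    "('k, 'm) ring_scheme \<Rightarrow> ('k, 'a, 'n) module_scheme \<Rightarrow> ('a \<Rightarrow> 'a tensor2 multiplier) \<Rightarrow>
     'a \<Rightarrow> 'a \<Rightarrow> 'a tensor2 multiplier" where
  "comult_right k A \<Delta> a b = \<Delta> a \<otimes>\<^bsub>multiplier_algebra k (tensor k A A)\<^esub>
     multiplier_tensor k A A \<one>\<^bsub>multiplier_algebra k A\<^esub> (multiplier_embedding A b)"

definition comult_left ::
    "('k, 'm) ring_scheme \<Rightarrow> ('k, 'a, 'n) module_scheme \<Rightarrow> ('a \<Rightarrow> 'a tensor2 multiplier) \<Rightarrow>
     'a \<Rightarrow> 'a \<Rightarrow> 'a tensor2 multiplier" where
  "comult_left k A \<Delta> a b =
     multiplier_tensor k A A (multiplier_embedding A a) \<one>\<^bsub>multiplier_algebra k A\<^esub>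
     \<otimes>\<^bsub>multiplier_algebra k (tensor k A A)\<^esub> \<Delta> b"

text \<open>
  The same as elements of the tensor square: \<open>sweedler_right \<dots> a b\<close> is
  \<open>a\<^sub>(\<^sub>1\<^sub>,\<^sub>b\<^sub>) \<otimes> a\<^sub>(\<^sub>2\<^sub>,\<^sub>b\<^sub>)\<close>, corresponding to \<open>\<Delta>(a)(1 \<otimes> b)\<close>, and
  \<open>sweedler_left \<dots> a b\<close> is \<open>b\<^sub>(\<^sub>a\<^sub>,\<^sub>1\<^sub>) \<otimes> b\<^sub>(\<^sub>a\<^sub>,\<^sub>2\<^sub>)\<close>, corresponding to
  \<open>(a \<otimes> 1)\<Delta>(b)\<close>.
\<close>

definition sweedler_right ::
    "('k, 'm) ring_scheme \<Rightarrow> ('k, 'a, 'n) module_scheme \<Rightarrow> ('a \<Rightarrow> 'a tensor2 multiplier) \<Rightarrow>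
     'a \<Rightarrow> 'a \<Rightarrow> 'a tensor2" where
  "sweedler_right k A \<Delta> a b = inv_into (carrier (tensor k A A))
     (multiplier_embedding (tensor k A A)) (comult_right k A \<Delta> a b)"

definition sweedler_left ::
    "('k, 'm) ring_scheme \<Rightarrow> ('k, 'a, 'n) module_scheme \<Rightarrow> ('a \<Rightarrow> 'a tensor2 multiplier) \<Rightarrow>
     'a \<Rightarrow> 'a \<Rightarrow> 'a tensor2" where
  "sweedler_left k A \<Delta> a b = inv_into (carrier (tensor k A A))
     (multiplier_embedding (tensor k A A)) (comult_left k A \<Delta> a b)"

text \<open>
  Coassociativity is an equality of multipliers of the threefold tensor product.  Its left-hand side
  is formed on \<open>(A \<otimes> A) \<otimes> A\<close>, its right-hand side on \<open>A \<otimes> (A \<otimes> A)\<close>, and the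
  former is transported along the associativity isomorphism.  A multiplier \<open>\<Delta>(x)\<close> on two
  legs and an element \<open>y\<close> on the third are combined to the multiplier
  \<open>\<Delta>(x) \<otimes> \<iota>(y)\<close>, and similarly with the legs exchanged.
\<close>

locale multiplier_hopf_algebra = nondegenerate_algebra k A for k (structure) and A (structure) +
  fixes \<Delta> :: "'c \<Rightarrow> 'c tensor2 multiplier"
  assumes projective: "projective_module k A"
    and comult: "\<Delta> \<in> algebra_maps k A (multiplier_algebra k (tensor k A A))"
    and comult_right_range: "a \<in> carrier A \<Longrightarrow> b \<in> carrier A \<Longrightarrow>
      comult_right k A \<Delta> a b \<in> multiplier_embedding (tensor k A A) ` carrier (tensor k A A)"
    and comult_left_range: "a \<in> carrier A \<Longrightarrow> b \<in> carrier A \<Longrightarrow>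
      comult_left k A \<Delta> a b \<in> multiplier_embedding (tensor k A A) ` carrier (tensor k A A)"
    and coassociative: "a \<in> carrier A \<Longrightarrow> b \<in> carrier A \<Longrightarrow> c \<in> carrier A \<Longrightarrow>
      multiplier_transport (tensor k (tensor k A A) A) (tensor k A (tensor k A A)) (tensor_assoc k A A A)
        (multiplier_tensor k (tensor k A A) A
           (multiplier_tensor k A A (multiplier_embedding A a) \<one>\<^bsub>multiplier_algebra k A\<^esub>)
           \<one>\<^bsub>multiplier_algebra k A\<^esub>
         \<otimes>\<^bsub>multiplier_algebra k (tensor k (tensor k A A) A)\<^esub>
         tensor_lift (multiplier_algebra k (tensor k (tensor k A A) A))
           (\<lambda>x y. multiplier_tensor k (tensor k A A) A (\<Delta> x) (multiplier_embedding A y))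
           (sweedler_right k A \<Delta> b c))
      = tensor_lift (multiplier_algebra k (tensor k A (tensor k A A)))
           (\<lambda>x y. multiplier_tensor k A (tensor k A A) (multiplier_embedding A x) (\<Delta> y))
           (sweedler_left k A \<Delta> a b)
         \<otimes>\<^bsub>multiplier_algebra k (tensor k A (tensor k A A))\<^esub>
         multiplier_tensor k A (tensor k A A) \<one>\<^bsub>multiplier_algebra k A\<^esub>
           (multiplier_tensor k A A \<one>\<^bsub>multiplier_algebra k A\<^esub> (multiplier_embedding A c))"
    and T1_bij: "bij_betw (tensor_lift (tensor k A A) (sweedler_right k A \<Delta>))
      (carrier (tensor k A A)) (carrier (tensor k A A))"
    and T2_bij: "bij_betw (tensor_lift (tensor k A A) (sweedler_left k A \<Delta>))
      (carrier (tensor k A A)) (carrier (tensor k A A))"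

definition is_counit ::
    "('k, 'm) ring_scheme \<Rightarrow> ('k, 'a, 'n) module_scheme \<Rightarrow> ('a \<Rightarrow> 'a tensor2 multiplier) \<Rightarrow>
     ('a \<Rightarrow> 'k) \<Rightarrow> bool" where
  "is_counit k A \<Delta> \<epsilon> \<longleftrightarrow> \<epsilon> \<in> algebra_maps k A (scalar_algebra k) \<and>
     (\<forall>a\<in>carrier A. \<forall>b\<in>carrier A.
        tensor_lift A (\<lambda>x y. \<epsilon> y \<odot>\<^bsub>A\<^esub> x) (sweedler_left k A \<Delta> a b) = a \<otimes>\<^bsub>A\<^esub> b \<and>
        tensor_lift A (\<lambda>x y. \<epsilon> x \<odot>\<^bsub>A\<^esub> y) (sweedler_right k A \<Delta> a b) = a \<otimes>\<^bsub>A\<^esub> b)"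

text \<open>
  In a multiplier Hopf algebra a map with this property is unique, because the maps
  \<open>T\<^sub>1\<close> and \<open>T\<^sub>2\<close> are bijective and the algebra is non-degenerate.
\<close>

definition is_antipode ::
    "('k, 'm) ring_scheme \<Rightarrow> ('k, 'a, 'n) module_scheme \<Rightarrow> ('a \<Rightarrow> 'a tensor2 multiplier) \<Rightarrow>
     ('a \<Rightarrow> 'k) \<Rightarrow> ('a \<Rightarrow> 'a multiplier) \<Rightarrow> bool" where
  "is_antipode k A \<Delta> \<epsilon> S \<longleftrightarrow> S \<in> linear_maps k A (multiplier_algebra k A) \<and>
     (\<forall>a\<in>carrier A. \<forall>b\<in>carrier A.
        tensor_lift A (\<lambda>x y. S x \<triangleright> y) (sweedler_right k A \<Delta> a b) = \<epsilon> a \<odot>\<^bsub>A\<^esub> b \<and>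
        tensor_lift A (\<lambda>x y. x \<triangleleft> S y) (sweedler_left k A \<Delta> a b) = \<epsilon> b \<odot>\<^bsub>A\<^esub> a)"


section \<open>Convolution inverses\<close>

text \<open>
  Elements of \<open>Hom(A, Hom(A, \<bbbM>(A)))\<close>; the first argument is the parameter \<open>b\<close> of
  \<open>f \<ast>\<^sup>b g\<close> and \<open>f \<ast>\<^sub>b g\<close>.
\<close>

definition convolution_upper ::
    "('k, 'm) ring_scheme \<Rightarrow> ('k, 'a, 'n) module_scheme \<Rightarrow> ('a \<Rightarrow> 'a tensor2 multiplier) \<Rightarrow>
     ('a \<Rightarrow> 'a multiplier) \<Rightarrow> ('a \<Rightarrow> 'a multiplier) \<Rightarrow> 'a \<Rightarrow> 'a \<Rightarrow> 'a multiplier" where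
  "convolution_upper k A \<Delta> f g = (\<lambda>b\<in>carrier A. \<lambda>a\<in>carrier A.
     tensor_lift (multiplier_algebra k A) (\<lambda>x y. f x \<otimes>\<^bsub>multiplier_algebra k A\<^esub> g y)
       (sweedler_right k A \<Delta> a b))"

definition convolution_lower ::
    "('k, 'm) ring_scheme \<Rightarrow> ('k, 'a, 'n) module_scheme \<Rightarrow> ('a \<Rightarrow> 'a tensor2 multiplier) \<Rightarrow>
     ('a \<Rightarrow> 'a multiplier) \<Rightarrow> ('a \<Rightarrow> 'a multiplier) \<Rightarrow> 'a \<Rightarrow> 'a \<Rightarrow> 'a multiplier" where
  "convolution_lower k A \<Delta> f g = (\<lambda>b\<in>carrier A. \<lambda>a\<in>carrier A.
     tensor_lift (multiplier_algebra k A) (\<lambda>x y. f x \<otimes>\<^bsub>multiplier_algebra k A\<^esub> g y)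
       (sweedler_left k A \<Delta> b a))"

definition convolution_unit ::
    "('k, 'm) ring_scheme \<Rightarrow> ('k, 'a, 'n) module_scheme \<Rightarrow> ('a \<Rightarrow> 'k) \<Rightarrow> 'a \<Rightarrow> 'a \<Rightarrow> 'a multiplier" where
  "convolution_unit k A \<epsilon> = (\<lambda>b\<in>carrier A. \<lambda>a\<in>carrier A.
     \<epsilon> a \<odot>\<^bsub>multiplier_algebra k A\<^esub> multiplier_embedding A b)"

definition is_convolution_inverse ::
    "('k, 'm) ring_scheme \<Rightarrow> ('k, 'a, 'n) module_scheme \<Rightarrow> ('a \<Rightarrow> 'a tensor2 multiplier) \<Rightarrow>
     ('a \<Rightarrow> 'k) \<Rightarrow> ('a \<Rightarrow> 'a multiplier) \<Rightarrow> ('a \<Rightarrow> 'a multiplier) \<Rightarrow> bool" where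
  "is_convolution_inverse k A \<Delta> \<epsilon> f f' \<longleftrightarrow>
     f' \<in> linear_maps k A (multiplier_algebra k A) \<and>
     convolution_upper k A \<Delta> f' f = convolution_unit k A \<epsilon> \<and>
     convolution_lower k A \<Delta> f f' = convolution_unit k A \<epsilon>"

end

theory Submission
  imports Defs
begin

text \<open>
  The two notions express the same equations, once inside \<open>A\<close> and once inside the
  multiplier algebra.  For a multiplier \<open>x\<close> and \<open>a \<in> A\<close>, the products
  \<open>x \<cdot> \<iota>(a)\<close> and \<open>\<iota>(a) \<cdot> x\<close> are again images of elements of \<open>A\<close>, namely
  \<open>\<iota>(x \<triangleright> a)\<close> and \<open>\<iota>(a \<triangleleft> x)\<close>.  Hence the integrands
  of the convolutions \<open>S \<ast>\<^sup>b \<iota>\<close> and \<open>\<iota> \<ast>\<^sub>b S\<close> arise by applying \<open>\<iota>\<close> to the integrands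
  of the two antipode equations.  Since \<open>\<iota>\<close> is linear, it commutes with the summation over the
  Sweedler components (\<open>tensor_lift_hom\<close>), so each convolution equation is the image under
  \<open>\<iota>\<close> of the corresponding antipode equation.  Non-degeneracy makes \<open>\<iota>\<close> injective, and
  therefore the equations in the multiplier algebra imply those in \<open>A\<close>.

  The technical point is that the sum over a tensor is independent of its representative.
  It is checked on the generating relations of the tensor product, and only for the integrands with
  values in \<open>A\<close>: those with values in the multiplier algebra inherit it through \<open>\<iota>\<close>.
\<close>


section \<open>Sums over a tensor\<close>

definition frag_eval ::
    "('k, 'c, 'q) module_scheme \<Rightarrow> ('a \<Rightarrow> 'b \<Rightarrow> 'c) \<Rightarrow> ('a \<times> 'b \<Rightarrow>\<^sub>0 int) \<Rightarrow> 'c" where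
  "frag_eval P \<beta> u =
     (\<Oplus>\<^bsub>P\<^esub>p\<in>Poly_Mapping.keys u. [Poly_Mapping.lookup u p] \<cdot>\<^bsub>P\<^esub> \<beta> (fst p) (snd p))"

lemma tensor_lift_eq_the_elem: "tensor_lift P \<beta> X = the_elem (frag_eval P \<beta> ` X)"
  by (simp add: tensor_lift_def frag_eval_def)

text \<open>
  Scalars enter only through the balancing condition, the form in which they occur in the relations
  of the tensor product, which is a quotient of a free abelian group.
\<close>

definition balanced_map ::
    "('k, 'm) ring_scheme \<Rightarrow> ('k, 'a, 'n) module_scheme \<Rightarrow> ('k, 'b, 'p) module_scheme \<Rightarrow>
     ('k, 'c, 'q) module_scheme \<Rightarrow> ('a \<Rightarrow> 'b \<Rightarrow> 'c) \<Rightarrow> bool" where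
  "balanced_map k M N P \<beta> \<longleftrightarrow>
     (\<forall>x\<in>carrier M. \<forall>y\<in>carrier N. \<beta> x y \<in> carrier P) \<and>
     (\<forall>x\<in>carrier M. \<forall>x'\<in>carrier M. \<forall>y\<in>carrier N. \<beta> (x \<oplus>\<^bsub>M\<^esub> x') y = \<beta> x y \<oplus>\<^bsub>P\<^esub> \<beta> x' y) \<and>
     (\<forall>x\<in>carrier M. \<forall>y\<in>carrier N. \<forall>y'\<in>carrier N. \<beta> x (y \<oplus>\<^bsub>N\<^esub> y') = \<beta> x y \<oplus>\<^bsub>P\<^esub> \<beta> x y') \<and>
     (\<forall>r\<in>carrier k. \<forall>x\<in>carrier M. \<forall>y\<in>carrier N. \<beta> (r \<odot>\<^bsub>M\<^esub> x) y = \<beta> x (r \<odot>\<^bsub>N\<^esub> y))"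

text \<open>
  Sums over the supports of different representatives are compared on a common finite index set.
\<close>

lemma frag_eval_superset:
  assumes P: "abelian_group P" and cl: "\<And>x y. (x, y) \<in> K \<Longrightarrow> \<beta> x y \<in> carrier P"
    and F: "finite F" "Poly_Mapping.keys u \<subseteq> F" "F \<subseteq> K"
  shows "frag_eval P \<beta> u =
    (\<Oplus>\<^bsub>P\<^esub>p\<in>F. [Poly_Mapping.lookup u p] \<cdot>\<^bsub>P\<^esub> \<beta> (fst p) (snd p))"
proof -
  interpret abelian_group P by (rule P)
  have "\<beta> (fst p) (snd p) \<in> carrier P" if "p \<in> F" for p
    using that F cl[of "fst p" "snd p"] by auto
  then show ?thesis
    unfolding frag_eval_def using F
    by (intro add.finprod_mono_neutral_cong_left)
       (auto simp: in_keys_iff add_pow_def intro!: add.int_pow_closed[unfolded add_pow_def])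
qed

lemma frag_eval_hom:
  assumes P: "abelian_group P" and cl: "\<And>x y. (x, y) \<in> K \<Longrightarrow> \<beta> x y \<in> carrier P"
  shows "frag_eval P \<beta> \<in> hom (free_Abelian_group K) (add_monoid P)"
proof -
  interpret abelian_group P by (rule P)
  have cl': "\<beta> (fst p) (snd p) \<in> carrier P" if "p \<in> K" for p
    using that cl[of "fst p" "snd p"] by auto
  show ?thesis
  proof (rule homI)
    fix u assume "u \<in> carrier (free_Abelian_group K)"
    then show "frag_eval P \<beta> u \<in> carrier (add_monoid P)"
      unfolding frag_eval_def using cl' by (auto intro!: finsum_closed add.int_pow_closed)
  next
    fix u v assume uv: "u \<in> carrier (free_Abelian_group K)" "v \<in> carrier (free_Abelian_group K)"
    let ?F = "Poly_Mapping.keys u \<union> Poly_Mapping.keys v"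
    have F: "finite ?F" "?F \<subseteq> K" using uv by auto
    have "frag_eval P \<beta> (u + v) =
        (\<Oplus>\<^bsub>P\<^esub>p\<in>?F. [Poly_Mapping.lookup (u + v) p] \<cdot>\<^bsub>P\<^esub> \<beta> (fst p) (snd p))"
      using frag_eval_superset[OF P cl F(1) keys_add F(2)] by simp
    also have "\<dots> = (\<Oplus>\<^bsub>P\<^esub>p\<in>?F. [Poly_Mapping.lookup u p] \<cdot>\<^bsub>P\<^esub> \<beta> (fst p) (snd p)
        \<oplus>\<^bsub>P\<^esub> [Poly_Mapping.lookup v p] \<cdot>\<^bsub>P\<^esub> \<beta> (fst p) (snd p))"
      using F cl' by (intro finsum_cong') (auto simp: lookup_add add.int_pow_mult add.int_pow_closed subset_iff)
    also have "\<dots> = (\<Oplus>\<^bsub>P\<^esub>p\<in>?F. [Poly_Mapping.lookup u p] \<cdot>\<^bsub>P\<^esub> \<beta> (fst p) (snd p))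
        \<oplus>\<^bsub>P\<^esub> (\<Oplus>\<^bsub>P\<^esub>p\<in>?F. [Poly_Mapping.lookup v p] \<cdot>\<^bsub>P\<^esub> \<beta> (fst p) (snd p))"
      using F cl' by (intro finsum_addf) (auto intro!: add.int_pow_closed)
    also have "\<dots> = frag_eval P \<beta> u \<oplus>\<^bsub>P\<^esub> frag_eval P \<beta> v"
      using frag_eval_superset[OF P cl F(1) _ F(2)] by simp
    finally show "frag_eval P \<beta> (u \<otimes>\<^bsub>free_Abelian_group K\<^esub> v) =
        frag_eval P \<beta> u \<otimes>\<^bsub>add_monoid P\<^esub> frag_eval P \<beta> v" by simp
  qed
qed

lemma frag_eval_frag_of:
  assumes P: "abelian_group P" and cl: "\<beta> x y \<in> carrier P"
  shows "frag_eval P \<beta> (frag_of (x, y)) = \<beta> x y"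
proof -
  interpret abelian_group P by (rule P)
  show ?thesis
    using cl by (simp add: frag_eval_def add.int_pow_1)
qed

text \<open>
  The relations are generated by differences that a balanced map evaluates to zero, and the kernel
  of a group homomorphism is a subgroup.
\<close>

lemma frag_eval_tensor_relations:
  assumes P: "abelian_group P" and M: "module k M" and N: "module k N"
    and bal: "balanced_map k M N P \<beta>" and u: "u \<in> tensor_relations k M N"
  shows "frag_eval P \<beta> u = \<zero>\<^bsub>P\<^esub>"
proof -
  interpret P: abelian_group P by (rule P)
  interpret M: module k M by (rule M)
  interpret N: module k N by (rule N)
  let ?K = "carrier M \<times> carrier N"
  let ?F = "free_Abelian_group ?K"
  have cl: "\<beta> x y \<in> carrier P" if "(x, y) \<in> ?K" for x y
    using bal that by (auto simp: balanced_map_def)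
  have h: "frag_eval P \<beta> \<in> hom ?F (add_monoid P)"
    by (rule frag_eval_hom[OF P cl])
  interpret h: group_hom ?F "add_monoid P" "frag_eval P \<beta>"
    by (auto simp: group_hom_def group_hom_axioms_def h P.a_group)
  have diff: "frag_eval P \<beta> (v - w) = frag_eval P \<beta> v \<ominus>\<^bsub>P\<^esub> frag_eval P \<beta> w"
    if "Poly_Mapping.keys v \<subseteq> ?K" "Poly_Mapping.keys w \<subseteq> ?K" for v w
    using h.hom_mult[of v "- w"] h.hom_inv[of w] that
    by (simp add: P.minus_eq a_inv_def)
  have keys_diff': "Poly_Mapping.keys (v - w) \<subseteq> ?K"
    if "Poly_Mapping.keys v \<subseteq> ?K" "Poly_Mapping.keys w \<subseteq> ?K" for v w
    using that keys_diff[of v w] by blast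
  have of: "frag_eval P \<beta> (frag_of (x, y)) = \<beta> x y" if "x \<in> carrier M" "y \<in> carrier N" for x y
    using that by (intro frag_eval_frag_of[OF P]) (auto intro: cl)
  have cancel: "a \<oplus>\<^bsub>P\<^esub> b \<ominus>\<^bsub>P\<^esub> a \<ominus>\<^bsub>P\<^esub> b = \<zero>\<^bsub>P\<^esub>" if "a \<in> carrier P" "b \<in> carrier P" for a b
  proof -
    have "a \<oplus>\<^bsub>P\<^esub> b \<ominus>\<^bsub>P\<^esub> a \<ominus>\<^bsub>P\<^esub> b = (a \<oplus>\<^bsub>P\<^esub> b) \<ominus>\<^bsub>P\<^esub> (a \<oplus>\<^bsub>P\<^esub> b)"
      using that by (simp add: P.minus_eq P.a_assoc P.minus_add)
    with that show ?thesis by (simp add: P.minus_eq P.r_neg)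
  qed
  have "tensor_relations k M N \<subseteq> kernel ?F (add_monoid P) (frag_eval P \<beta>)"
    unfolding tensor_relations_def
  proof (rule h.generate_subgroup_incl[OF _ h.subgroup_kernel], intro Un_least subsetI; clarsimp simp: kernel_def)
    fix x x' y assume a: "x \<in> carrier M" "x' \<in> carrier M" "y \<in> carrier N"
    then show "Poly_Mapping.keys (frag_of (x \<oplus>\<^bsub>M\<^esub> x', y) - frag_of (x, y) - frag_of (x', y)) \<subseteq> ?K \<and>
        frag_eval P \<beta> (frag_of (x \<oplus>\<^bsub>M\<^esub> x', y) - frag_of (x, y) - frag_of (x', y)) = \<zero>\<^bsub>P\<^esub>"
      using bal by (simp add: diff of keys_diff' balanced_map_def cancel)
  next
    fix x y y' assume a: "x \<in> carrier M" "y \<in> carrier N" "y' \<in> carrier N"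
    then show "Poly_Mapping.keys (frag_of (x, y \<oplus>\<^bsub>N\<^esub> y') - frag_of (x, y) - frag_of (x, y')) \<subseteq> ?K \<and>
        frag_eval P \<beta> (frag_of (x, y \<oplus>\<^bsub>N\<^esub> y') - frag_of (x, y) - frag_of (x, y')) = \<zero>\<^bsub>P\<^esub>"
      using bal by (simp add: diff of keys_diff' balanced_map_def cancel)
  next
    fix r x y assume a: "r \<in> carrier k" "x \<in> carrier M" "y \<in> carrier N"
    then show "Poly_Mapping.keys (frag_of (r \<odot>\<^bsub>M\<^esub> x, y) - frag_of (x, r \<odot>\<^bsub>N\<^esub> y)) \<subseteq> ?K \<and>
        frag_eval P \<beta> (frag_of (r \<odot>\<^bsub>M\<^esub> x, y) - frag_of (x, r \<odot>\<^bsub>N\<^esub> y)) = \<zero>\<^bsub>P\<^esub>"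
      using bal by (simp add: diff of keys_diff' balanced_map_def P.minus_eq P.r_neg)
  qed
  with u show ?thesis by (auto simp: kernel_def)
qed

lemma subgroup_tensor_relations:
  assumes M: "module k M" and N: "module k N"
  shows "subgroup (tensor_relations k M N) (free_Abelian_group (carrier M \<times> carrier N))"
proof -
  interpret M: module k M by (rule M)
  interpret N: module k N by (rule N)
  interpret F: group "free_Abelian_group (carrier M \<times> carrier N)" by simp
  show ?thesis
    unfolding tensor_relations_def
    by (rule F.generate_is_subgroup) (auto dest!: keys_diff[THEN subsetD] split: if_splits)
qed

lemma frag_eval_image_tensor:
  assumes P: "abelian_group P" and M: "module k M" and N: "module k N"
    and bal: "balanced_map k M N P \<beta>" and X: "X \<in> carrier (tensor k M N)"
  obtains c where "c \<in> carrier P" "frag_eval P \<beta> ` X = {c}"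
proof -
  interpret P: abelian_group P by (rule P)
  let ?K = "carrier M \<times> carrier N"
  let ?F = "free_Abelian_group ?K"
  have h: "frag_eval P \<beta> \<in> hom ?F (add_monoid P)"
    using bal by (intro frag_eval_hom[OF P]) (auto simp: balanced_map_def)
  interpret F: group ?F by simp
  have rel: "subgroup (tensor_relations k M N) ?F"
    by (rule subgroup_tensor_relations[OF M N])
  from X obtain u where u: "u \<in> carrier ?F" and Xu: "X = tensor_relations k M N #>\<^bsub>?F\<^esub> u"
    by (auto simp: tensor_def Let_def FactGroup_def RCOSETS_def)
  have eval: "frag_eval P \<beta> v = frag_eval P \<beta> u" if "v \<in> X" for v
  proof -
    from that Xu obtain w where w: "w \<in> tensor_relations k M N" "v = w \<otimes>\<^bsub>?F\<^esub> u"
      by (auto simp: r_coset_def)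
    have "frag_eval P \<beta> v = frag_eval P \<beta> w \<oplus>\<^bsub>P\<^esub> frag_eval P \<beta> u"
      using w u hom_mult[OF h subgroup.mem_carrier[OF rel w(1)] u] by simp
    then show ?thesis
      using frag_eval_tensor_relations[OF P M N bal w(1)] hom_in_carrier[OF h u] by simp
  qed
  have "u \<in> X"
    using F.rcos_self[OF u rel] Xu by simp
  have "frag_eval P \<beta> ` X = (\<lambda>_. frag_eval P \<beta> u) ` X"
    by (rule image_cong[OF refl eval])
  also have "\<dots> = {frag_eval P \<beta> u}"
    by (rule image_constant) (rule \<open>u \<in> X\<close>)
  finally have "frag_eval P \<beta> ` X = {frag_eval P \<beta> u}" .
  then show thesis
    using that hom_in_carrier[OF h u] by auto
qed

lemma tensor_lift_closed:
  assumes "abelian_group P" "module k M" "module k N"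
    and "balanced_map k M N P \<beta>" "X \<in> carrier (tensor k M N)"
  shows "tensor_lift P \<beta> X \<in> carrier P"
  by (rule frag_eval_image_tensor[OF assms]) (simp add: tensor_lift_eq_the_elem)

text \<open>
  An additive map \<open>h\<close> commutes with the sum over each representative separately.  So
  \<open>h \<circ> \<beta>\<close> takes a single value on the representatives because \<open>\<beta>\<close> does.
\<close>

lemma tensor_lift_hom:
  assumes P: "abelian_group P" and Q: "abelian_group Q" and M: "module k M" and N: "module k N"
    and bal: "balanced_map k M N P \<beta>" and X: "X \<in> carrier (tensor k M N)"
    and h: "h \<in> hom (add_monoid P) (add_monoid Q)"
    and \<gamma>: "\<And>x y. x \<in> carrier M \<Longrightarrow> y \<in> carrier N \<Longrightarrow> \<gamma> x y = h (\<beta> x y)"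
  shows "tensor_lift Q \<gamma> X = h (tensor_lift P \<beta> X)"
proof -
  interpret P: abelian_group P by (rule P)
  interpret Q: abelian_group Q by (rule Q)
  interpret h: group_hom "add_monoid P" "add_monoid Q" h
    by (auto simp: group_hom_def group_hom_axioms_def h P.a_group Q.a_group)
  let ?K = "carrier M \<times> carrier N"
  have cl: "\<beta> (fst p) (snd p) \<in> carrier P" if "p \<in> ?K" for p
    using bal that by (auto simp: balanced_map_def)
  have sum: "h (\<Oplus>\<^bsub>P\<^esub>p\<in>B. f p) = (\<Oplus>\<^bsub>Q\<^esub>p\<in>B. h (f p))"
    if "finite B" "f \<in> B \<rightarrow> carrier P" for B f
    using that
  proof (induction B rule: finite_induct)
    case empty
    then show ?case using h.hom_one by simp
  next
    case (insert p B)
    then have f: "f p \<in> carrier P" "f \<in> B \<rightarrow> carrier P"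
      by simp_all
    then have hf: "h (f p) \<in> carrier Q" "(\<lambda>p. h (f p)) \<in> B \<rightarrow> carrier Q"
      using h.hom_closed by (simp_all add: Pi_def)
    from f have "h (f p \<oplus>\<^bsub>P\<^esub> finsum P f B) = h (f p) \<oplus>\<^bsub>Q\<^esub> h (finsum P f B)"
      using h.hom_mult[of "f p" "finsum P f B"] by simp
    with insert f hf show ?case
      by simp
  qed
  have eval: "frag_eval Q \<gamma> u = h (frag_eval P \<beta> u)" if "u \<in> X" for u
  proof -
    interpret F: group "free_Abelian_group ?K" by simp
    have "tensor_relations k M N \<subseteq> carrier (free_Abelian_group ?K)"
      by (rule subgroup.subset[OF subgroup_tensor_relations[OF M N]])
    moreover from X obtain v where "v \<in> carrier (free_Abelian_group ?K)"
        "X = tensor_relations k M N #>\<^bsub>free_Abelian_group ?K\<^esub> v"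
      by (auto simp: tensor_def Let_def FactGroup_def RCOSETS_def)
    ultimately have "u \<in> carrier (free_Abelian_group ?K)"
      using that F.r_coset_subset_G by blast
    then have K: "Poly_Mapping.keys u \<subseteq> ?K"
      by simp
    have "h (frag_eval P \<beta> u) = (\<Oplus>\<^bsub>Q\<^esub>p\<in>Poly_Mapping.keys u.
        h ([Poly_Mapping.lookup u p] \<cdot>\<^bsub>P\<^esub> \<beta> (fst p) (snd p)))"
      unfolding frag_eval_def using K cl by (intro sum) (auto intro!: P.add.int_pow_closed)
    also have "\<dots> = frag_eval Q \<gamma> u"
      unfolding frag_eval_def
    proof (rule Q.finsum_cong')
      fix p assume "p \<in> Poly_Mapping.keys u"
      then have p: "p \<in> ?K" using K by blast
      then have "\<beta> (fst p) (snd p) \<in> carrier (add_monoid P)"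
        using cl by simp
      from h.hom_int_pow[OF this]
      have "h ([Poly_Mapping.lookup u p] \<cdot>\<^bsub>P\<^esub> \<beta> (fst p) (snd p)) =
          [Poly_Mapping.lookup u p] \<cdot>\<^bsub>Q\<^esub> h (\<beta> (fst p) (snd p))"
        unfolding add_pow_def by this
      then show "h ([Poly_Mapping.lookup u p] \<cdot>\<^bsub>P\<^esub> \<beta> (fst p) (snd p)) =
          [Poly_Mapping.lookup u p] \<cdot>\<^bsub>Q\<^esub> \<gamma> (fst p) (snd p)"
        using \<gamma>[of "fst p" "snd p"] p by (simp add: mem_Times_iff)
    next
      show "(\<lambda>p. [Poly_Mapping.lookup u p] \<cdot>\<^bsub>Q\<^esub> \<gamma> (fst p) (snd p)) \<in> Poly_Mapping.keys u \<rightarrow> carrier Q"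
      proof
        fix p assume "p \<in> Poly_Mapping.keys u"
        then have p: "p \<in> ?K" using K by blast
        then have "\<gamma> (fst p) (snd p) \<in> carrier Q"
          using h.hom_closed[of "\<beta> (fst p) (snd p)"] cl[OF p] \<gamma>[of "fst p" "snd p"]
          by (simp add: mem_Times_iff)
        then show "[Poly_Mapping.lookup u p] \<cdot>\<^bsub>Q\<^esub> \<gamma> (fst p) (snd p) \<in> carrier Q"
          by (rule Q.add.int_pow_closed)
      qed
    qed simp
    finally show ?thesis by simp
  qed
  obtain c where c: "frag_eval P \<beta> ` X = {c}"
    using frag_eval_image_tensor[OF P M N bal X] by metis
  have "frag_eval Q \<gamma> ` X = h ` frag_eval P \<beta> ` X"
    using eval by (simp add: image_image)
  with c show ?thesis
    by (simp add: tensor_lift_eq_the_elem)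
qed


section \<open>Multipliers and the canonical embedding\<close>

context nonunital_algebra
begin

abbreviation mult_alg where "mult_alg \<equiv> multiplier_algebra k A"
abbreviation \<iota> where "\<iota> \<equiv> multiplier_embedding A"

lemma multiplierI:
  assumes "\<And>a. a \<in> carrier A \<Longrightarrow> f a \<in> carrier A" "\<And>a. a \<in> carrier A \<Longrightarrow> g a \<in> carrier A"
    and "\<And>a b. a \<in> carrier A \<Longrightarrow> b \<in> carrier A \<Longrightarrow> f (a \<oplus>\<^bsub>A\<^esub> b) = f a \<oplus>\<^bsub>A\<^esub> f b"
    and "\<And>a b. a \<in> carrier A \<Longrightarrow> b \<in> carrier A \<Longrightarrow> g (a \<oplus>\<^bsub>A\<^esub> b) = g a \<oplus>\<^bsub>A\<^esub> g b"
    and "\<And>r a. r \<in> carrier k \<Longrightarrow> a \<in> carrier A \<Longrightarrow> f (r \<odot>\<^bsub>A\<^esub> a) = r \<odot>\<^bsub>A\<^esub> f a"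
    and "\<And>r a. r \<in> carrier k \<Longrightarrow> a \<in> carrier A \<Longrightarrow> g (r \<odot>\<^bsub>A\<^esub> a) = r \<odot>\<^bsub>A\<^esub> g a"
    and "\<And>a b. a \<in> carrier A \<Longrightarrow> b \<in> carrier A \<Longrightarrow> f (a \<otimes>\<^bsub>A\<^esub> b) = f a \<otimes>\<^bsub>A\<^esub> b"
    and "\<And>a b. a \<in> carrier A \<Longrightarrow> b \<in> carrier A \<Longrightarrow> g (a \<otimes>\<^bsub>A\<^esub> b) = a \<otimes>\<^bsub>A\<^esub> g b"
    and "\<And>a b. a \<in> carrier A \<Longrightarrow> b \<in> carrier A \<Longrightarrow> a \<otimes>\<^bsub>A\<^esub> f b = g a \<otimes>\<^bsub>A\<^esub> b"
  shows "(\<lambda>a\<in>carrier A. f a, \<lambda>a\<in>carrier A. g a) \<in> carrier mult_alg"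
  using assms by (simp add: multiplier_algebra_def linear_maps_def mult_closed)

lemma multiplier_closed:
  assumes "x \<in> carrier mult_alg" "a \<in> carrier A"
  shows "x \<triangleright> a \<in> carrier A" "a \<triangleleft> x \<in> carrier A"
  using assms by (auto simp: multiplier_algebra_def linear_maps_def)

lemma multiplier_laws:
  assumes "x \<in> carrier mult_alg" "a \<in> carrier A" "b \<in> carrier A"
  shows "x \<triangleright> (a \<oplus>\<^bsub>A\<^esub> b) = (x \<triangleright> a) \<oplus>\<^bsub>A\<^esub> (x \<triangleright> b)"
    and "(a \<oplus>\<^bsub>A\<^esub> b) \<triangleleft> x = (a \<triangleleft> x) \<oplus>\<^bsub>A\<^esub> (b \<triangleleft> x)"
    and "r \<in> carrier k \<Longrightarrow> x \<triangleright> (r \<odot>\<^bsub>A\<^esub> a) = r \<odot>\<^bsub>A\<^esub> (x \<triangleright> a)"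
    and "r \<in> carrier k \<Longrightarrow> (r \<odot>\<^bsub>A\<^esub> a) \<triangleleft> x = r \<odot>\<^bsub>A\<^esub> (a \<triangleleft> x)"
    and "x \<triangleright> (a \<otimes>\<^bsub>A\<^esub> b) = (x \<triangleright> a) \<otimes>\<^bsub>A\<^esub> b"
    and "(a \<otimes>\<^bsub>A\<^esub> b) \<triangleleft> x = a \<otimes>\<^bsub>A\<^esub> (b \<triangleleft> x)"
    and "a \<otimes>\<^bsub>A\<^esub> (x \<triangleright> b) = (a \<triangleleft> x) \<otimes>\<^bsub>A\<^esub> b"
  using assms by (auto simp: multiplier_algebra_def linear_maps_def)

lemma mult_zero:
  assumes "a \<in> carrier A"
  shows "\<zero>\<^bsub>A\<^esub> \<otimes>\<^bsub>A\<^esub> a = \<zero>\<^bsub>A\<^esub>" "a \<otimes>\<^bsub>A\<^esub> \<zero>\<^bsub>A\<^esub> = \<zero>\<^bsub>A\<^esub>"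
  using assms mult_smult_left[of "\<zero>\<^bsub>k\<^esub>" "\<zero>\<^bsub>A\<^esub>" a] mult_smult_right[of "\<zero>\<^bsub>k\<^esub>" a "\<zero>\<^bsub>A\<^esub>"]
  by (simp_all add: mult_closed)

lemma multiplier_smult_closed:
  assumes r: "r \<in> carrier k" and x: "x \<in> carrier mult_alg"
  shows "r \<odot>\<^bsub>mult_alg\<^esub> x \<in> carrier mult_alg"
proof -
  have comm: "r \<odot>\<^bsub>A\<^esub> (s \<odot>\<^bsub>A\<^esub> a) = s \<odot>\<^bsub>A\<^esub> (r \<odot>\<^bsub>A\<^esub> a)" if "s \<in> carrier k" "a \<in> carrier A" for s a
    using that r smult_assoc1[of r s a] smult_assoc1[of s r a] R.m_comm[of r s] by simp
  have "(\<lambda>a\<in>carrier A. r \<odot>\<^bsub>A\<^esub> (x \<triangleright> a), \<lambda>a\<in>carrier A. r \<odot>\<^bsub>A\<^esub> (a \<triangleleft> x)) \<in> carrier mult_alg"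
    using r by (intro multiplierI)
      (simp_all add: multiplier_closed[OF x] multiplier_laws[OF x] smult_r_distr comm
        mult_smult_left mult_smult_right)
  then show ?thesis by (simp add: multiplier_algebra_def)
qed

lemma abelian_group_multiplier_algebra: "abelian_group mult_alg"
proof (rule abelian_groupI)
  fix x y assume x: "x \<in> carrier mult_alg" and y: "y \<in> carrier mult_alg"
  have "(\<lambda>a\<in>carrier A. (x \<triangleright> a) \<oplus>\<^bsub>A\<^esub> (y \<triangleright> a), \<lambda>a\<in>carrier A. (a \<triangleleft> x) \<oplus>\<^bsub>A\<^esub> (a \<triangleleft> y)) \<in> carrier mult_alg"
    by (rule multiplierI)
      (simp_all add: multiplier_closed[OF x] multiplier_laws[OF x] multiplier_closed[OF y]
        multiplier_laws[OF y] smult_r_distr mult_add_left mult_add_right M.a_ac)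
  then show "x \<oplus>\<^bsub>mult_alg\<^esub> y \<in> carrier mult_alg"
    by (simp add: multiplier_algebra_def)
next
  have "(\<lambda>a\<in>carrier A. \<zero>\<^bsub>A\<^esub>, \<lambda>a\<in>carrier A. \<zero>\<^bsub>A\<^esub>) \<in> carrier mult_alg"
    by (rule multiplierI) (simp_all add: mult_zero)
  then show "\<zero>\<^bsub>mult_alg\<^esub> \<in> carrier mult_alg"
    by (simp add: multiplier_algebra_def)
next
  fix x y z assume "x \<in> carrier mult_alg" "y \<in> carrier mult_alg" "z \<in> carrier mult_alg"
  note cl = this[THEN multiplier_closed(1)] this[THEN multiplier_closed(2)]
  show "x \<oplus>\<^bsub>mult_alg\<^esub> y \<oplus>\<^bsub>mult_alg\<^esub> z = x \<oplus>\<^bsub>mult_alg\<^esub> (y \<oplus>\<^bsub>mult_alg\<^esub> z)"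
    by (auto simp: multiplier_algebra_def fun_eq_iff cl M.a_assoc)
next
  fix x y assume "x \<in> carrier mult_alg" "y \<in> carrier mult_alg"
  note cl = this[THEN multiplier_closed(1)] this[THEN multiplier_closed(2)]
  show "x \<oplus>\<^bsub>mult_alg\<^esub> y = y \<oplus>\<^bsub>mult_alg\<^esub> x"
    by (auto simp: multiplier_algebra_def fun_eq_iff cl M.a_comm)
next
  fix x assume x: "x \<in> carrier mult_alg"
  then have "fst x \<in> extensional (carrier A)" "snd x \<in> extensional (carrier A)"
    by (auto simp: multiplier_algebra_def linear_maps_def PiE_def)
  then show "\<zero>\<^bsub>mult_alg\<^esub> \<oplus>\<^bsub>mult_alg\<^esub> x = x"
    by (auto simp: multiplier_algebra_def prod_eq_iff fun_eq_iff multiplier_closed[OF x] extensional_def)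
next
  fix x assume x: "x \<in> carrier mult_alg"
  \<comment> \<open>Negation is scalar multiplication by \<open>-1\<close>, so closure under scalars suffices.\<close>
  let ?y = "(\<ominus>\<^bsub>k\<^esub> \<one>\<^bsub>k\<^esub>) \<odot>\<^bsub>mult_alg\<^esub> x"
  have "?y \<oplus>\<^bsub>mult_alg\<^esub> x = \<zero>\<^bsub>mult_alg\<^esub>"
    by (auto simp: multiplier_algebra_def fun_eq_iff multiplier_closed[OF x] smult_l_minus M.l_neg)
  moreover have "?y \<in> carrier mult_alg"
    by (rule multiplier_smult_closed[OF _ x]) simp
  ultimately show "\<exists>y\<in>carrier mult_alg. y \<oplus>\<^bsub>mult_alg\<^esub> x = \<zero>\<^bsub>mult_alg\<^esub>"
    by blast
qed

lemma embedding_hom: "\<iota> \<in> hom (add_monoid A) (add_monoid mult_alg)"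
proof (rule homI)
  fix a assume a: "a \<in> carrier (add_monoid A)"
  then have "(\<lambda>b\<in>carrier A. a \<otimes>\<^bsub>A\<^esub> b, \<lambda>b\<in>carrier A. b \<otimes>\<^bsub>A\<^esub> a) \<in> carrier mult_alg"
    by (intro multiplierI)
      (simp_all add: mult_closed mult_assoc mult_add_left mult_add_right mult_smult_left mult_smult_right)
  with a show "\<iota> a \<in> carrier (add_monoid mult_alg)"
    by (simp add: multiplier_embedding_def)
next
  fix a b assume "a \<in> carrier (add_monoid A)" "b \<in> carrier (add_monoid A)"
  then show "\<iota> (a \<otimes>\<^bsub>add_monoid A\<^esub> b) = \<iota> a \<otimes>\<^bsub>add_monoid mult_alg\<^esub> \<iota> b"
    by (auto simp: multiplier_embedding_def multiplier_algebra_def fun_eq_iff mult_add_left mult_add_right)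
qed

lemma embedding_smult:
  assumes "r \<in> carrier k" "a \<in> carrier A"
  shows "\<iota> (r \<odot>\<^bsub>A\<^esub> a) = r \<odot>\<^bsub>mult_alg\<^esub> \<iota> a"
  using assms
  by (auto simp: multiplier_embedding_def multiplier_algebra_def fun_eq_iff mult_smult_left mult_smult_right)

text \<open>
  The image of \<open>\<iota>\<close> is a two-sided ideal of the multiplier algebra: in one component the identity
  below is the linearity of \<open>x\<close> over \<open>A\<close>, in the other the compatibility
  \<open>b (x \<triangleright> a) = (b \<triangleleft> x) a\<close>.
\<close>

lemma multiplier_mult_embedding:
  assumes x: "x \<in> carrier mult_alg" and a: "a \<in> carrier A"
  shows "x \<otimes>\<^bsub>mult_alg\<^esub> \<iota> a = \<iota> (x \<triangleright> a)"
proof -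
  have "x \<otimes>\<^bsub>mult_alg\<^esub> \<iota> a =
      (\<lambda>b\<in>carrier A. x \<triangleright> (a \<otimes>\<^bsub>A\<^esub> b), \<lambda>b\<in>carrier A. (b \<triangleleft> x) \<otimes>\<^bsub>A\<^esub> a)"
    using a by (auto simp: multiplier_embedding_def multiplier_algebra_def fun_eq_iff multiplier_closed[OF x])
  also have "\<dots> = \<iota> (x \<triangleright> a)"
    using a by (auto simp: multiplier_embedding_def fun_eq_iff multiplier_closed[OF x] multiplier_laws[OF x])
  finally show ?thesis .
qed

lemma embedding_mult_multiplier:
  assumes x: "x \<in> carrier mult_alg" and a: "a \<in> carrier A"
  shows "\<iota> a \<otimes>\<^bsub>mult_alg\<^esub> x = \<iota> (a \<triangleleft> x)"
proof -
  have "\<iota> a \<otimes>\<^bsub>mult_alg\<^esub> x =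
      (\<lambda>b\<in>carrier A. a \<otimes>\<^bsub>A\<^esub> (x \<triangleright> b), \<lambda>b\<in>carrier A. (b \<otimes>\<^bsub>A\<^esub> a) \<triangleleft> x)"
    using a by (auto simp: multiplier_embedding_def multiplier_algebra_def fun_eq_iff multiplier_closed[OF x])
  also have "\<dots> = \<iota> (a \<triangleleft> x)"
    using a by (auto simp: multiplier_embedding_def fun_eq_iff multiplier_closed[OF x] multiplier_laws[OF x])
  finally show ?thesis .
qed

lemma linear_map_to_multipliers:
  assumes "S \<in> linear_maps k A mult_alg" and a: "a \<in> carrier A"
  shows "S a \<in> carrier mult_alg"
    and "b \<in> carrier A \<Longrightarrow> S (a \<oplus>\<^bsub>A\<^esub> b) = S a \<oplus>\<^bsub>mult_alg\<^esub> S b"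
    and "r \<in> carrier k \<Longrightarrow> S (r \<odot>\<^bsub>A\<^esub> a) = r \<odot>\<^bsub>mult_alg\<^esub> S a"
  using assms by (auto simp: linear_maps_def)

lemma multiplier_module_action:
  assumes "a \<in> carrier A"
  shows "(x \<oplus>\<^bsub>mult_alg\<^esub> y) \<triangleright> a = (x \<triangleright> a) \<oplus>\<^bsub>A\<^esub> (y \<triangleright> a)"
    and "a \<triangleleft> (x \<oplus>\<^bsub>mult_alg\<^esub> y) = (a \<triangleleft> x) \<oplus>\<^bsub>A\<^esub> (a \<triangleleft> y)"
    and "(r \<odot>\<^bsub>mult_alg\<^esub> x) \<triangleright> a = r \<odot>\<^bsub>A\<^esub> (x \<triangleright> a)"
    and "a \<triangleleft> (r \<odot>\<^bsub>mult_alg\<^esub> x) = r \<odot>\<^bsub>A\<^esub> (a \<triangleleft> x)"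
  using assms by (simp_all add: multiplier_algebra_def)

lemma balanced_left_action:
  assumes S: "S \<in> linear_maps k A mult_alg"
  shows "balanced_map k A A A (\<lambda>x y. S x \<triangleright> y)"
  by (simp add: balanced_map_def linear_map_to_multipliers[OF S] multiplier_closed multiplier_laws
      multiplier_module_action)

lemma balanced_right_action:
  assumes S: "S \<in> linear_maps k A mult_alg"
  shows "balanced_map k A A A (\<lambda>x y. x \<triangleleft> S y)"
  by (simp add: balanced_map_def linear_map_to_multipliers[OF S] multiplier_closed multiplier_laws
      multiplier_module_action)

lemma tensor_lift_mult_embedding:
  assumes S: "S \<in> linear_maps k A mult_alg" and X: "X \<in> carrier (tensor k A A)"
  shows "tensor_lift mult_alg (\<lambda>x y. S x \<otimes>\<^bsub>mult_alg\<^esub> \<iota> y) X =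
    \<iota> (tensor_lift A (\<lambda>x y. S x \<triangleright> y) X)"
  by (rule tensor_lift_hom[OF M.abelian_group_axioms abelian_group_multiplier_algebra
        module_axioms module_axioms balanced_left_action[OF S] X embedding_hom])
     (simp add: multiplier_mult_embedding linear_map_to_multipliers[OF S])

lemma tensor_lift_embedding_mult:
  assumes S: "S \<in> linear_maps k A mult_alg" and X: "X \<in> carrier (tensor k A A)"
  shows "tensor_lift mult_alg (\<lambda>x y. \<iota> x \<otimes>\<^bsub>mult_alg\<^esub> S y) X =
    \<iota> (tensor_lift A (\<lambda>x y. x \<triangleleft> S y) X)"
  by (rule tensor_lift_hom[OF M.abelian_group_axioms abelian_group_multiplier_algebra
        module_axioms module_axioms balanced_right_action[OF S] X embedding_hom])
     (simp add: embedding_mult_multiplier linear_map_to_multipliers[OF S])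

end

text \<open>
  If \<open>\<iota>(a) = \<iota>(b)\<close>, then the left components give \<open>(a - b) c = 0\<close> for all \<open>c\<close>.
\<close>

lemma (in nondegenerate_algebra) inj_on_embedding: "inj_on \<iota> (carrier A)"
proof (rule inj_onI)
  fix a b assume a: "a \<in> carrier A" and b: "b \<in> carrier A" and eq: "\<iota> a = \<iota> b"
  have "a \<ominus>\<^bsub>A\<^esub> b = \<zero>\<^bsub>A\<^esub>"
  proof (rule nondegenerate_right)
    fix c assume c: "c \<in> carrier A"
    have "a \<otimes>\<^bsub>A\<^esub> c = b \<otimes>\<^bsub>A\<^esub> c"
      using arg_cong[OF eq, of "\<lambda>x. x \<triangleright> c"] a b c by (simp add: multiplier_embedding_def)
    moreover have "a \<otimes>\<^bsub>A\<^esub> c = (a \<ominus>\<^bsub>A\<^esub> b) \<otimes>\<^bsub>A\<^esub> c \<oplus>\<^bsub>A\<^esub> b \<otimes>\<^bsub>A\<^esub> c"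
      using a b c by (simp flip: mult_add_left add: M.minus_eq M.a_assoc M.l_neg)
    ultimately show "(a \<ominus>\<^bsub>A\<^esub> b) \<otimes>\<^bsub>A\<^esub> c = \<zero>\<^bsub>A\<^esub>"
      using M.add.right_cancel[of "b \<otimes>\<^bsub>A\<^esub> c" "(a \<ominus>\<^bsub>A\<^esub> b) \<otimes>\<^bsub>A\<^esub> c" "\<zero>\<^bsub>A\<^esub>"] a b c
      by (simp add: mult_closed)
  qed (use a b in simp)
  moreover have "a = (a \<ominus>\<^bsub>A\<^esub> b) \<oplus>\<^bsub>A\<^esub> b"
    using a b by (simp add: M.minus_eq M.a_assoc M.l_neg)
  ultimately show "a = b"
    using b by simp
qed


section \<open>Antipodes are convolution inverses\<close>

theorem proposition3p6:
  fixes k :: "('k, 'm) ring_scheme"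
    and A :: "('k, 'a, 'n) module_scheme"
    and \<Delta> :: "'a \<Rightarrow> 'a tensor2 multiplier"
    and \<epsilon> :: "'a \<Rightarrow> 'k"
    and S :: "'a \<Rightarrow> 'a multiplier"
  assumes "multiplier_hopf_algebra k A \<Delta>"
    and "is_counit k A \<Delta> \<epsilon>"
    and "S \<in> linear_maps k A (multiplier_algebra k A)"
  shows "is_antipode k A \<Delta> \<epsilon> S \<longleftrightarrow>
    is_convolution_inverse k A \<Delta> \<epsilon> (multiplier_embedding A) S"
proof -
  interpret multiplier_hopf_algebra k A \<Delta> by (rule assms(1))
  have S: "S \<in> linear_maps k A mult_alg" by (rule assms(3))
  have eps: "\<epsilon> a \<in> carrier k" if "a \<in> carrier A" for a
    using assms(2) that
    by (auto simp: is_counit_def algebra_maps_def linear_maps_def scalar_algebra_def)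
  have upper: "tensor_lift mult_alg (\<lambda>x y. S x \<otimes>\<^bsub>mult_alg\<^esub> \<iota> y) (sweedler_right k A \<Delta> a b) =
        \<epsilon> a \<odot>\<^bsub>mult_alg\<^esub> \<iota> b \<longleftrightarrow>
      tensor_lift A (\<lambda>x y. S x \<triangleright> y) (sweedler_right k A \<Delta> a b) = \<epsilon> a \<odot>\<^bsub>A\<^esub> b"
    if a: "a \<in> carrier A" and b: "b \<in> carrier A" for a b
  proof -
    have X: "sweedler_right k A \<Delta> a b \<in> carrier (tensor k A A)"
      unfolding sweedler_right_def by (rule inv_into_into[OF comult_right_range[OF a b]])
    have "tensor_lift A (\<lambda>x y. S x \<triangleright> y) (sweedler_right k A \<Delta> a b) \<in> carrier A"
      by (rule tensor_lift_closed[OF M.abelian_group_axioms module_axioms module_axioms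
            balanced_left_action[OF S] X])
    then show ?thesis
      using inj_on_eq_iff[OF inj_on_embedding] eps[OF a] b
      by (simp add: tensor_lift_mult_embedding[OF S X] flip: embedding_smult)
  qed
  have lower: "tensor_lift mult_alg (\<lambda>x y. \<iota> x \<otimes>\<^bsub>mult_alg\<^esub> S y) (sweedler_left k A \<Delta> a b) =
        \<epsilon> b \<odot>\<^bsub>mult_alg\<^esub> \<iota> a \<longleftrightarrow>
      tensor_lift A (\<lambda>x y. x \<triangleleft> S y) (sweedler_left k A \<Delta> a b) = \<epsilon> b \<odot>\<^bsub>A\<^esub> a"
    if a: "a \<in> carrier A" and b: "b \<in> carrier A" for a b
  proof -
    have X: "sweedler_left k A \<Delta> a b \<in> carrier (tensor k A A)"
      unfolding sweedler_left_def by (rule inv_into_into[OF comult_left_range[OF a b]])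
    have "tensor_lift A (\<lambda>x y. x \<triangleleft> S y) (sweedler_left k A \<Delta> a b) \<in> carrier A"
      by (rule tensor_lift_closed[OF M.abelian_group_axioms module_axioms module_axioms
            balanced_right_action[OF S] X])
    then show ?thesis
      using inj_on_eq_iff[OF inj_on_embedding] eps[OF b] a
      by (simp add: tensor_lift_embedding_mult[OF S X] flip: embedding_smult)
  qed
  have restrict_eq: "(\<lambda>b\<in>carrier A. \<lambda>a\<in>carrier A. F b a) = (\<lambda>b\<in>carrier A. \<lambda>a\<in>carrier A. G b a) \<longleftrightarrow>
      (\<forall>b\<in>carrier A. \<forall>a\<in>carrier A. F b a = G b a)" for F G :: "'a \<Rightarrow> 'a \<Rightarrow> 'a multiplier"
    by (auto simp: fun_eq_iff restrict_def)
  show ?thesis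
    using S by (auto simp: is_antipode_def is_convolution_inverse_def convolution_upper_def
        convolution_lower_def convolution_unit_def restrict_eq upper lower)
qed

end
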